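(* Let $(X,X_{\mathbb{R}},\|\cdot\|_X)$ and $(Y,Y_{\mathbb{R}},\|\cdot\|_Y)$ be normed complexified spaces with $$\|x\|_X^2=\langle\operatorname{Re}x,\operatorname{Re}x\rangle+\langle\operatorname{Im}x,\operatorname{Im}x\rangle\quad(x\in X),\qquad \|y\|_Y^2=(\operatorname{Re}y,\operatorname{Re}y)+(\operatorname{Im}y,\operatorname{Im}y)\quad(y\in Y),$$ where $\langle\cdot,\cdot\rangle$ and $(\cdot,\cdot)$ are inner products on the real vector spaces $X_{\mathbb{R}}$ and $Y_{\mathbb{R}}$, respectively. Then $\|A\|_{X,Y}^{\mathbb{R}}=\|A\|_{X,Y}^{\mathbb{C}}$ for every $\mathbb{C}$-linear operator $A:X\to Y$ satisfying $A(X_{\mathbb{R}})\subseteq Y_{\mathbb{R}}$.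
   Context: A normed complexified space is a triple $(X,X_{\mathbb{R}},\|\cdot\|_X)$ where $X$ is a complex vector space, $X_{\mathbb{R}}$ is a real vector space, $X$ is the algebraic complexification of $X_{\mathbb{R}}$ (each $x\in X$ is uniquely $x=x_1+ix_2$ with $x_1,x_2\in X_{\mathbb{R}}$; put $\operatorname{Re}x=x_1$, $\operatorname{Im}x=x_2$), and $\|\cdot\|_X$ is a norm on the complex vector space $X$. The operator norms, with values in $[0,\infty]$, are $$\|A\|_{X,Y}^{\mathbb{C}}=\sup_{x\in X\setminus\{0\}}\frac{\|Ax\|_Y}{\|x\|_X},\qquad \|A\|_{X,Y}^{\mathbb{R}}=\sup_{x\in X_{\mathbb{R}}\setminus\{0\}}\frac{\|Ax\|_Y}{\|x\|_X}.$$ *)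

theory Defs
  imports Complex_Main "HOL-Library.Extended_Nonnegative_Real"
begin

text \<open>The distribution has no type class of complex vector spaces, so a complex vector space
  is given by an explicit scalar multiplication on a type.  The real form \<open>XR\<close> is a subset that is
  a subspace for the restriction of the scalars to the reals.\<close>

locale complexified_space = vector_space scale
  for scale :: "complex \<Rightarrow> 'a::ab_group_add \<Rightarrow> 'a" +
  fixes XR :: "'a set"
  assumes real_subspace: "module.subspace (\<lambda>r::real. scale (complex_of_real r)) XR"
    and decomposition: "\<exists>!p. p \<in> XR \<times> XR \<and> x = fst p + scale \<i> (snd p)"

locale normed_complexified_space = complexified_space scale XR
  for scale :: "complex \<Rightarrow> 'a::ab_group_add \<Rightarrow> 'a" and XR :: "'a set" +
  fixes nrm :: "'a \<Rightarrow> real"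
  assumes nrm_nonneg: "0 \<le> nrm x"
    and nrm_eq_0_iff: "nrm x = 0 \<longleftrightarrow> x = 0"
    and nrm_scale: "nrm (scale c x) = cmod c * nrm x"
    and nrm_triangle: "nrm (x + y) \<le> nrm x + nrm y"

definition re_part :: "(complex \<Rightarrow> 'a::ab_group_add \<Rightarrow> 'a) \<Rightarrow> 'a set \<Rightarrow> 'a \<Rightarrow> 'a" where
  "re_part scale XR x = (THE x1. x1 \<in> XR \<and> (\<exists>x2\<in>XR. x = x1 + scale \<i> x2))"

definition im_part :: "(complex \<Rightarrow> 'a::ab_group_add \<Rightarrow> 'a) \<Rightarrow> 'a set \<Rightarrow> 'a \<Rightarrow> 'a" where
  "im_part scale XR x = (THE x2. x2 \<in> XR \<and> (\<exists>x1\<in>XR. x = x1 + scale \<i> x2))"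

text \<open>An inner product on the real vector space \<open>XR\<close>; the values of \<open>ip\<close> outside \<open>XR\<close> are
  irrelevant.\<close>

definition real_inner_product_on ::
    "(complex \<Rightarrow> 'a::ab_group_add \<Rightarrow> 'a) \<Rightarrow> 'a set \<Rightarrow> ('a \<Rightarrow> 'a \<Rightarrow> real) \<Rightarrow> bool" where
  "real_inner_product_on scale XR ip \<longleftrightarrow>
     (\<forall>x\<in>XR. \<forall>y\<in>XR. ip x y = ip y x) \<and>
     (\<forall>x\<in>XR. \<forall>y\<in>XR. \<forall>z\<in>XR. ip (x + y) z = ip x z + ip y z) \<and>
     (\<forall>r::real. \<forall>x\<in>XR. \<forall>y\<in>XR. ip (scale (complex_of_real r) x) y = r * ip x y) \<and>
     (\<forall>x\<in>XR. 0 \<le> ip x x) \<and>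
     (\<forall>x\<in>XR. ip x x = 0 \<longleftrightarrow> x = 0)"

text \<open>With values in \<^typ>\<open>ennreal\<close> the supremum always exists, and it is \<open>0\<close> for the zero space.\<close>

definition op_norm_C ::
    "('a::ab_group_add \<Rightarrow> real) \<Rightarrow> ('b \<Rightarrow> real) \<Rightarrow> ('a \<Rightarrow> 'b) \<Rightarrow> ennreal" where
  "op_norm_C nX nY A = (SUP x\<in>UNIV - {0}. ennreal (nY (A x) / nX x))"

definition op_norm_R ::
    "'a::ab_group_add set \<Rightarrow> ('a \<Rightarrow> real) \<Rightarrow> ('b \<Rightarrow> real) \<Rightarrow> ('a \<Rightarrow> 'b) \<Rightarrow> ennreal" where
  "op_norm_R XR nX nY A = (SUP x\<in>XR - {0}. ennreal (nY (A x) / nX x))"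

end

theory Submission
  imports Defs
begin

text \<open>The two inner products make the norms Pythagorean with respect to the real forms:
  \<open>\<parallel>a + \<i> b\<parallel>\<^sup>2 = \<parallel>a\<parallel>\<^sup>2 + \<parallel>b\<parallel>\<^sup>2\<close> for real vectors \<open>a\<close> and \<open>b\<close> (lemma \<open>nrm_pythagoras\<close>).
  As \<open>A\<close> sends real vectors to real vectors, \<open>A (a + \<i> b) = A a + \<i> A b\<close> is again the decomposition
  into real and imaginary part, so the squared quotient of \<open>A\<close> at \<open>a + \<i> b\<close> is
  \<open>(\<parallel>A a\<parallel>\<^sup>2 + \<parallel>A b\<parallel>\<^sup>2) / (\<parallel>a\<parallel>\<^sup>2 + \<parallel>b\<parallel>\<^sup>2)\<close>.  This is a mediant of the squared quotients at \<open>a\<close> and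
  \<open>b\<close>, hence at most the larger of them (lemma \<open>real_vector_with_larger_quotient\<close>).  Therefore
  complex vectors contribute nothing to the supremum beyond what real vectors do; this argument
  compares single quotients, so it covers unbounded operators as well.\<close>

context complexified_space
begin

lemma real_scalars_module: "module (\<lambda>r::real. scale (complex_of_real r))"
  by unfold_locales (simp_all add: algebra_simps)

lemma zero_mem_real_form: "0 \<in> XR"
  using real_subspace module.subspace_0[OF real_scalars_module] by blast

lemma decompE:
  obtains a b where "a \<in> XR" "b \<in> XR" "x = a + scale \<i> b"
proof -
  obtain p where "p \<in> XR \<times> XR" "x = fst p + scale \<i> (snd p)"
    using ex1_implies_ex[OF decomposition[of x]] by blast
  then show thesis using that[of "fst p" "snd p"] by auto
qed

lemma decomp_unique:
  assumes "a \<in> XR" "b \<in> XR" "c \<in> XR" "d \<in> XR" "a + scale \<i> b = c + scale \<i> d"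
  shows "a = c \<and> b = d"
proof -
  from decomposition[of "a + scale \<i> b"] obtain p where
    p: "\<forall>q. q \<in> XR \<times> XR \<and> a + scale \<i> b = fst q + scale \<i> (snd q) \<longrightarrow> q = p"
    by (rule ex1E) (rule that)
  have "(a, b) = p" by (rule p[rule_format]) (simp add: assms(1,2))
  moreover have "(c, d) = p" by (rule p[rule_format]) (simp add: assms(3-5))
  ultimately show ?thesis by (metis prod.inject)
qed

lemma re_part_decomp:
  assumes "a \<in> XR" "b \<in> XR"
  shows "re_part scale XR (a + scale \<i> b) = a"
  unfolding re_part_def by (rule the_equality) (use assms decomp_unique in \<open>metis+\<close>)

lemma im_part_decomp:
  assumes "a \<in> XR" "b \<in> XR"
  shows "im_part scale XR (a + scale \<i> b) = b"
  unfolding im_part_def by (rule the_equality) (use assms decomp_unique in \<open>metis+\<close>)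

text \<open>The hypothesis determines the norm on real vectors too: a real vector \<open>a\<close> has the
  decomposition \<open>a + \<i> 0\<close>, whence \<open>\<parallel>a\<parallel>\<^sup>2 = ip a a\<close>.\<close>

lemma nrm_pythagoras:
  assumes ip: "real_inner_product_on scale XR ip"
    and nrm: "\<And>x. (nrm x)\<^sup>2 = ip (re_part scale XR x) (re_part scale XR x)
                          + ip (im_part scale XR x) (im_part scale XR x)"
    and "a \<in> XR" "b \<in> XR"
  shows "(nrm (a + scale \<i> b))\<^sup>2 = (nrm a)\<^sup>2 + (nrm b)\<^sup>2"
proof -
  have "(nrm c)\<^sup>2 = ip c c" if "c \<in> XR" for c
  proof -
    have "re_part scale XR c = c" "im_part scale XR c = 0"
      using re_part_decomp[OF that zero_mem_real_form] im_part_decomp[OF that zero_mem_real_form]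
      by simp_all
    moreover have "ip 0 0 = 0"
      using ip zero_mem_real_form by (simp add: real_inner_product_on_def)
    ultimately show ?thesis using nrm[of c] by simp
  qed
  then show ?thesis
    using nrm[of "a + scale \<i> b"] assms(3,4) by (simp add: re_part_decomp im_part_decomp)
qed

end

text \<open>If every nonzero real vector had a quotient below the quotient \<open>q\<close> at \<open>x = a + \<i> b\<close>, then
  \<open>\<parallel>A a\<parallel>\<^sup>2 + \<parallel>A b\<parallel>\<^sup>2 < q\<^sup>2 (\<parallel>a\<parallel>\<^sup>2 + \<parallel>b\<parallel>\<^sup>2)\<close>, whereas the Pythagorean identities in both spaces
  make the two sides equal.\<close>

lemma real_vector_with_larger_quotient:
  assumes X: "normed_complexified_space sX XR nX"
    and Y: "normed_complexified_space sY YR nY"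
    and pythX: "\<And>a b. a \<in> XR \<Longrightarrow> b \<in> XR \<Longrightarrow> (nX (a + sX \<i> b))\<^sup>2 = (nX a)\<^sup>2 + (nX b)\<^sup>2"
    and pythY: "\<And>a b. a \<in> YR \<Longrightarrow> b \<in> YR \<Longrightarrow> (nY (a + sY \<i> b))\<^sup>2 = (nY a)\<^sup>2 + (nY b)\<^sup>2"
    and lin: "Vector_Spaces.linear sX sY A"
    and real: "A ` XR \<subseteq> YR"
    and "x \<noteq> 0"
  shows "\<exists>v\<in>XR - {0}. nY (A x) / nX x \<le> nY (A v) / nX v"
proof (rule ccontr)
  interpret X: normed_complexified_space sX XR nX by fact
  interpret Y: normed_complexified_space sY YR nY by fact
  interpret A: Vector_Spaces.linear sX sY A by fact
  define q where "q = nY (A x) / nX x"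
  assume "\<not> ?thesis"
  then have less: "nY (A v) / nX v < q" if "v \<in> XR" "v \<noteq> 0" for v
    using that by (auto simp: q_def not_le)
  have nX_pos: "0 < nX v" if "v \<noteq> 0" for v
    using that X.nrm_nonneg[of v] X.nrm_eq_0_iff[of v] by linarith
  have strict: "(nY (A v))\<^sup>2 < (q * nX v)\<^sup>2" if "v \<in> XR" "v \<noteq> 0" for v
    using less[OF that] nX_pos[OF that(2)] Y.nrm_nonneg[of "A v"]
    by (intro power_strict_mono) (simp_all add: pos_divide_less_eq)
  have zero: "nY (A 0) = 0" "nX 0 = 0"
    by (simp_all add: A.zero X.nrm_eq_0_iff Y.nrm_eq_0_iff)
  have weak: "(nY (A v))\<^sup>2 \<le> (q * nX v)\<^sup>2" if "v \<in> XR" for v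
    using strict[OF that] zero by (cases "v = 0") auto
  obtain a b where ab: "a \<in> XR" "b \<in> XR" "x = a + sX \<i> b"
    by (rule X.decompE)
  have "A x = A a + sY \<i> (A b)"
    by (simp add: ab A.add A.scale)
  then have "(nY (A x))\<^sup>2 = (nY (A a))\<^sup>2 + (nY (A b))\<^sup>2"
    using pythY ab real by auto
  also have "\<dots> < (q * nX a)\<^sup>2 + (q * nX b)\<^sup>2"
  proof (cases "a = 0")
    case True
    then have "b \<noteq> 0" using ab \<open>x \<noteq> 0\<close> by auto
    then show ?thesis using weak[OF ab(1)] strict[OF ab(2)] by linarith
  next
    case False
    then show ?thesis using strict[OF ab(1)] weak[OF ab(2)] by linarith
  qed
  also have "\<dots> = (q * nX x)\<^sup>2"
    using pythX[OF ab(1,2)] ab(3) by (simp add: power_mult_distrib distrib_left)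
  also have "\<dots> = (nY (A x))\<^sup>2"
    using nX_pos[OF \<open>x \<noteq> 0\<close>] by (simp add: q_def)
  finally show False by simp
qed

theorem theorem3p9:
  fixes sX :: "complex \<Rightarrow> 'a::ab_group_add \<Rightarrow> 'a" and XR :: "'a set" and nX :: "'a \<Rightarrow> real"
    and sY :: "complex \<Rightarrow> 'b::ab_group_add \<Rightarrow> 'b" and YR :: "'b set" and nY :: "'b \<Rightarrow> real"
    and ipX :: "'a \<Rightarrow> 'a \<Rightarrow> real" and ipY :: "'b \<Rightarrow> 'b \<Rightarrow> real"
    and A :: "'a \<Rightarrow> 'b"
  assumes "normed_complexified_space sX XR nX"
    and "normed_complexified_space sY YR nY"
    and "real_inner_product_on sX XR ipX"
    and "real_inner_product_on sY YR ipY"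
    and "\<And>x. (nX x)\<^sup>2 = ipX (re_part sX XR x) (re_part sX XR x)
                       + ipX (im_part sX XR x) (im_part sX XR x)"
    and "\<And>y. (nY y)\<^sup>2 = ipY (re_part sY YR y) (re_part sY YR y)
                       + ipY (im_part sY YR y) (im_part sY YR y)"
    and "Vector_Spaces.linear sX sY A"
    and "A ` XR \<subseteq> YR"
  shows "op_norm_R XR nX nY A = op_norm_C nX nY A"
proof (rule antisym)
  interpret X: normed_complexified_space sX XR nX by fact
  interpret Y: normed_complexified_space sY YR nY by fact
  show "op_norm_R XR nX nY A \<le> op_norm_C nX nY A"
    unfolding op_norm_R_def op_norm_C_def by (rule SUP_subset_mono) auto
  show "op_norm_C nX nY A \<le> op_norm_R XR nX nY A"
    unfolding op_norm_R_def op_norm_C_def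
  proof (rule SUP_mono)
    fix x :: 'a assume "x \<in> UNIV - {0}"
    then have "\<exists>v\<in>XR - {0}. nY (A x) / nX x \<le> nY (A v) / nX v"
      using X.nrm_pythagoras[OF assms(3,5)] Y.nrm_pythagoras[OF assms(4,6)] assms(1,2,7,8)
      by (intro real_vector_with_larger_quotient[where sX = sX and sY = sY and YR = YR]) auto
    then show "\<exists>v\<in>XR - {0}. ennreal (nY (A x) / nX x) \<le> ennreal (nY (A v) / nX v)"
      using ennreal_leI by blast
  qed
qed

end
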